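(* For every recognizable picture language $L$ (over a finite alphabet $\Sigma$) there exists an SA-hypergraph automaton $A$ such that the picture language associated to the graph language accepted by $A$ equals $L$, i.e. $p(\mathcal{L}(A)) = L$.
   Context: Pictures: a picture over a finite alphabet $\Sigma$ is an $h\times w$ matrix of letters of $\Sigma$; $\Sigma^{**}$ is the set of all pictures and a picture language is a subset of $\Sigma^{**}$. Two positions $(i,j),(i',j')$ are adjacent if $|i-i'|+|j-j'|=1$. Recognizability: a labelled Wang tile is a tuple $(c_N,c_E,c_S,c_W,l)$ with label $l\in\Sigma$ and edge colours $c_N,c_E,c_S,c_W\in C\cup\{\#\}$ (north, east, south, west), where $C$ is a finite set of colours and $\#\notin C$ means "uncoloured"; tiles cannot be rotated. A Wang tile system is $W=(\Sigma,C,\Theta)$ with $\Theta$ a finite set of such tiles. A picture $p$ of height $h$ and width $w$ belongs to $\mathcal{L}(W)$ iff there is a map $m:[h]\times[w]\to\Theta$ such that the label of $m(i,j)$ is $p_{(i,j)}$; for vertically adjacent positions $(i,j),(i+1,j)$ the south colour of $m(i,j)$ and the north colour of $m(i+1,j)$ are the same colour from $C$; for horizontally adjacent $(i,j),(i,j+1)$ the east colour of $m(i,j)$ and the west colour of $m(i,j+1)$ are the same colour from $C$; and for positions with $i=1$, $j=1$, $i=h$, $j=w$ the north, west, south, east colour respectively of $m(i,j)$ is $\#$. A picture language is recognizable if it equals $\mathcal{L}(W)$ for some Wang tile system $W$ (equivalently, it is recognized by a tiling system in the sense of Giammarresi–Restivo). Graphs: a pseudo-picture graph is $G=(N,E_v\cup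 E_h,\pi)$ with $N$ a finite node set, $E_v,E_h\subseteq N\times N$ disjoint ("vertical" and "horizontal" edges) and $\pi:N\to\Sigma$ a labelling. The subgraph induced by $N'\subseteq N$ keeps the nodes $N'$, the edges of $E_v,E_h$ between nodes of $N'$, and the restricted labelling; such subgraphs are called full subgraphs. $G$ is an $n\times m$ picture graph if there is a bijection $f_G:N\to[n]\times[m]$ with $(x,y)\in E_v$ iff $f_G(x)+(1,0)=f_G(y)$ and $(x,y)\in E_h$ iff $f_G(x)+(0,1)=f_G(y)$ (first coordinate = row, increasing downwards; second = column, increasing rightwards). It represents the picture $p(G)$ of height $n$, width $m$ with $p(G)_{(i,j)}=\pi(f_G^{-1}(i,j))$. $\mathcal{G}$ denotes the set of all picture graphs. A subgrid is a connected pseudo-picture graph that is a full subgraph of some picture graph. SA-hypergraph automata: a hypergraph is $H=(N,E,f)$ with finite node set $N$, finite set $E$ of hyperedges and $f:E\to\mathcal{P}(N)$. For $e\in E$, $I_H(e)=\{x\in N: \exists e'\in E\setminus\{e\},\ x\in f(e)\cap f(e')\}$. An SA-hypergraph automaton is $A=(N,E,f,d,G,E_0)$ where $(N,E,f)$ is a hypergraph, $d$ assigns to each $e\in E$ a pair written $d(e)=Q_1\to Q_2$ with $Q_1,Q_2\subseteq I_H(e)$ (incoming and outgoing active nodes), $G=(N,E_v\cup E_h,\pi)$ is a pseudo-picture graph (the underlying graph), and $E_0\subseteq E$ is the set of initial hyperedges. For $e\in E$, $G_e$ is the subgraph of $G$ induced by $f(e)$; it is required that $G_e$ and the subgraph of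 $G_e$ induced by $Q_1$ are connected. A configuration is $(M,O,g)$ where $M=(N_M,E_{M,v}\cup E_{M,h},\pi_M)$ is a subgrid, $O\subseteq N_M$ (active nodes) and $g:N_M\to N$ satisfies $\pi_M(x)=\pi(g(x))$. Given a configuration $(M_1,O_1,g_1)$ with $M_1$ having node set $N_1$ and edge sets $E_{1,v},E_{1,h}$, and $e\in E$ with $d(e)=Q_1\to Q_2$: if there is a nonempty $P\subseteq O_1$ such that $g_1|_P$ is a graph isomorphism from the subgraph of $M_1$ induced by $P$ onto the subgraph of $G_e$ induced by $Q_1$, then there is a transition $(M_1,O_1,g_1)\to_A(M_2,O_2,g_2)$ defined as follows: let $N'=\{x': x\in f(e)\setminus Q_1\}$ be fresh copies, $N_2=N_1\cup N'$, $g_2=g_1$ on $N_1$ and $g_2(x')=x$; $(x,y)\in E_{2,v}$ iff $(x,y)\in E_{1,v}$ or ($x,y\in P\cup N'$ and $(g_2(x),g_2(y))\in E_v$); analogously for $E_{2,h}$ with $E_h$; $\pi_2=\pi\circ g_2$; $O_2=(O_1\setminus P)\cup\{x'\in N': x\in Q_2\}$ (with $(M_2,O_2,g_2)$ being a configuration). $\overset{*}{\to}_A$ is the reflexive transitive closure. For $e\in E_0$ with $d(e)=Q_1\to O_e$, $(G_e,O_e,\mathrm{id})$ is an initial configuration. The accepted graph language is $\mathcal{L}(A)=\{M\in\mathcal{G}: \exists e\in E_0,\ (G_e,O_e,\mathrm{id})\overset{*}{\to}_A(M,\emptyset,g)\text{ for some } g\}$, and $p(\mathcal{L}(A))=\{p(M):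 M\in\mathcal{L}(A)\}$ is the associated picture language.
   Formalization: Transitions are corrected: a matched node of P lying over a node of Q_1 ∩ Q_2 stays active (O_2 also contains the x in P with g_2(x) in Q_2). With the literal O_2, accepted picture graphs have bounded treewidth, so the language of all nonempty one-letter pictures would be a counterexample. *)

theory Defs
  imports "HOL-Library.FuncSet" "Jordan_Normal_Form.Matrix"
begin

section \<open>Pictures and recognizability by Wang tiles\<close>

text \<open>
  Positions are counted from 0, as in the matrix library. Pictures have at least one row and one
  column: otherwise the picture represented by the empty graph would not be well defined.
\<close>

definition pictures :: "'a set \<Rightarrow> 'a mat set" where
  "pictures \<Sigma> = {p. 0 < dim_row p \<and> 0 < dim_col p \<and> elements_mat p \<subseteq> \<Sigma>}"

text \<open>\<^term>\<open>None\<close> stands for an uncoloured edge.\<close>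

record ('a, 'c) wang_tile =
  north :: "'c option"
  east  :: "'c option"
  south :: "'c option"
  west  :: "'c option"
  label :: 'a

record ('a, 'c) wang_tiles =
  colours :: "'c set"
  tiles   :: "('a, 'c) wang_tile set"

definition wang_tile_system :: "'a set \<Rightarrow> ('a, 'c) wang_tiles \<Rightarrow> bool" where
  "wang_tile_system \<Sigma> W \<longleftrightarrow>
     finite \<Sigma> \<and> finite (colours W) \<and> finite (tiles W) \<and>
     (\<forall>t\<in>tiles W. label t \<in> \<Sigma> \<and>
        {north t, east t, south t, west t} \<subseteq> insert None (Some ` colours W))"

definition wang_tiling ::
    "('a, 'c) wang_tiles \<Rightarrow> 'a mat \<Rightarrow> (nat \<times> nat \<Rightarrow> ('a, 'c) wang_tile) \<Rightarrow> bool" where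
  "wang_tiling W p m \<longleftrightarrow>
     (\<forall>i<dim_row p. \<forall>j<dim_col p. m (i, j) \<in> tiles W \<and> label (m (i, j)) = p $$ (i, j)) \<and>
     (\<forall>i j. i + 1 < dim_row p \<and> j < dim_col p \<longrightarrow>
        south (m (i, j)) = north (m (i + 1, j)) \<and> south (m (i, j)) \<in> Some ` colours W) \<and>
     (\<forall>i j. i < dim_row p \<and> j + 1 < dim_col p \<longrightarrow>
        east (m (i, j)) = west (m (i, j + 1)) \<and> east (m (i, j)) \<in> Some ` colours W) \<and>
     (\<forall>j<dim_col p. north (m (0, j)) = None \<and> south (m (dim_row p - 1, j)) = None) \<and>
     (\<forall>i<dim_row p. west (m (i, 0)) = None \<and> east (m (i, dim_col p - 1)) = None)"

definition wang_language :: "'a set \<Rightarrow> ('a, 'c) wang_tiles \<Rightarrow> 'a mat set" where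
  "wang_language \<Sigma> W = {p \<in> pictures \<Sigma>. \<exists>m. wang_tiling W p m}"

text \<open>Colour sets are finite, so natural numbers suffice as colours.\<close>

definition recognizable :: "'a set \<Rightarrow> 'a mat set \<Rightarrow> bool" where
  "recognizable \<Sigma> L \<longleftrightarrow>
     (\<exists>W :: ('a, nat) wang_tiles. wang_tile_system \<Sigma> W \<and> L = wang_language \<Sigma> W)"


section \<open>Picture graphs\<close>

record ('n, 'a) ppgraph =
  nodes :: "'n set"
  vert  :: "('n \<times> 'n) set"
  horiz :: "('n \<times> 'n) set"
  lab   :: "'n \<Rightarrow> 'a"

text \<open>Labellings are extensional, so that equality of records is equality of graphs.\<close>

definition pseudo_picture_graph :: "'a set \<Rightarrow> ('n, 'a) ppgraph \<Rightarrow> bool" where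
  "pseudo_picture_graph \<Sigma> G \<longleftrightarrow>
     finite (nodes G) \<and> vert G \<subseteq> nodes G \<times> nodes G \<and> horiz G \<subseteq> nodes G \<times> nodes G \<and>
     vert G \<inter> horiz G = {} \<and> lab G \<in> nodes G \<rightarrow>\<^sub>E \<Sigma>"

definition induced :: "('n, 'a) ppgraph \<Rightarrow> 'n set \<Rightarrow> ('n, 'a) ppgraph" where
  "induced G X =
     \<lparr>nodes = X, vert = vert G \<inter> X \<times> X, horiz = horiz G \<inter> X \<times> X, lab = restrict (lab G) X\<rparr>"

text \<open>
  Edge directions are ignored. The empty graph counts as connected; in particular a hyperedge may
  have no incoming active nodes.
\<close>

definition connected_graph :: "('n, 'a) ppgraph \<Rightarrow> bool" where
  "connected_graph G \<longleftrightarrow>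
     (\<forall>x\<in>nodes G. \<forall>y\<in>nodes G. (x, y) \<in> (vert G \<union> horiz G \<union> (vert G \<union> horiz G)\<inverse>)\<^sup>*)"

definition graph_iso :: "('n \<Rightarrow> 'm) \<Rightarrow> ('n, 'a) ppgraph \<Rightarrow> ('m, 'a) ppgraph \<Rightarrow> bool" where
  "graph_iso h G H \<longleftrightarrow>
     bij_betw h (nodes G) (nodes H) \<and>
     (\<forall>x\<in>nodes G. \<forall>y\<in>nodes G.
        ((x, y) \<in> vert G \<longleftrightarrow> (h x, h y) \<in> vert H) \<and>
        ((x, y) \<in> horiz G \<longleftrightarrow> (h x, h y) \<in> horiz H)) \<and>
     (\<forall>x\<in>nodes G. lab H (h x) = lab G x)"

definition grid_coords :: "('n, 'a) ppgraph \<Rightarrow> nat \<Rightarrow> nat \<Rightarrow> ('n \<Rightarrow> nat \<times> nat) \<Rightarrow> bool" where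
  "grid_coords G n m f \<longleftrightarrow>
     bij_betw f (nodes G) ({..<n} \<times> {..<m}) \<and>
     (\<forall>x\<in>nodes G. \<forall>y\<in>nodes G.
        ((x, y) \<in> vert G \<longleftrightarrow> f y = (fst (f x) + 1, snd (f x))) \<and>
        ((x, y) \<in> horiz G \<longleftrightarrow> f y = (fst (f x), snd (f x) + 1)))"

definition picture_graph :: "'a set \<Rightarrow> ('n, 'a) ppgraph \<Rightarrow> bool" where
  "picture_graph \<Sigma> G \<longleftrightarrow>
     pseudo_picture_graph \<Sigma> G \<and> (\<exists>n>0. \<exists>m>0. \<exists>f. grid_coords G n m f)"

text \<open>The dimensions and coordinates of a picture graph are unique, so this relation is functional.\<close>

definition represents :: "('n, 'a) ppgraph \<Rightarrow> 'a mat \<Rightarrow> bool" where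
  "represents G p \<longleftrightarrow>
     (\<exists>n>0. \<exists>m>0. \<exists>f. grid_coords G n m f \<and>
        p = mat n m (\<lambda>ij. lab G (inv_into (nodes G) f ij)))"

definition subgrid :: "'a set \<Rightarrow> ('n, 'a) ppgraph \<Rightarrow> bool" where
  "subgrid \<Sigma> M \<longleftrightarrow>
     pseudo_picture_graph \<Sigma> M \<and> connected_graph M \<and>
     (\<exists>G. picture_graph \<Sigma> G \<and> nodes M \<subseteq> nodes G \<and> M = induced G (nodes M))"


section \<open>SA-hypergraph automata\<close>

text \<open>
  The node set of the hypergraph is that of the underlying graph; \<open>ends\<close> is the incidence map of
  the hypergraph, and the two components of \<open>active e\<close> are the incoming and the outgoing active
  nodes of \<open>e\<close>.
\<close>

record ('n, 'e, 'a) sa_automaton =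
  hyperedges :: "'e set"
  ends       :: "'e \<Rightarrow> 'n set"
  active     :: "'e \<Rightarrow> 'n set \<times> 'n set"
  underlying :: "('n, 'a) ppgraph"
  initials   :: "'e set"

abbreviation incoming :: "('n, 'e, 'a) sa_automaton \<Rightarrow> 'e \<Rightarrow> 'n set" where
  "incoming A e \<equiv> fst (active A e)"

abbreviation outgoing :: "('n, 'e, 'a) sa_automaton \<Rightarrow> 'e \<Rightarrow> 'n set" where
  "outgoing A e \<equiv> snd (active A e)"

definition intersection_nodes :: "('n, 'e, 'a) sa_automaton \<Rightarrow> 'e \<Rightarrow> 'n set" where
  "intersection_nodes A e =
     {x \<in> nodes (underlying A). \<exists>e'\<in>hyperedges A - {e}. x \<in> ends A e \<inter> ends A e'}"

definition edge_graph :: "('n, 'e, 'a) sa_automaton \<Rightarrow> 'e \<Rightarrow> ('n, 'a) ppgraph" where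
  "edge_graph A e = induced (underlying A) (ends A e)"

definition sa_hypergraph_automaton :: "'a set \<Rightarrow> ('n, 'e, 'a) sa_automaton \<Rightarrow> bool" where
  "sa_hypergraph_automaton \<Sigma> A \<longleftrightarrow>
     finite \<Sigma> \<and> pseudo_picture_graph \<Sigma> (underlying A) \<and>
     finite (hyperedges A) \<and> initials A \<subseteq> hyperedges A \<and>
     (\<forall>e\<in>hyperedges A.
        ends A e \<subseteq> nodes (underlying A) \<and>
        incoming A e \<subseteq> intersection_nodes A e \<and>
        outgoing A e \<subseteq> intersection_nodes A e \<and>
        connected_graph (edge_graph A e) \<and>
        connected_graph (induced (edge_graph A e) (incoming A e)))"

type_synonym ('n, 'a) configuration = "('n, 'a) ppgraph \<times> 'n set \<times> ('n \<Rightarrow> 'n)"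

fun is_configuration ::
    "'a set \<Rightarrow> ('n, 'e, 'a) sa_automaton \<Rightarrow> ('n, 'a) configuration \<Rightarrow> bool" where
  "is_configuration \<Sigma> A (M, Act, g) \<longleftrightarrow>
     subgrid \<Sigma> M \<and> Act \<subseteq> nodes M \<and> g \<in> nodes M \<rightarrow>\<^sub>E nodes (underlying A) \<and>
     (\<forall>x\<in>nodes M. lab M x = lab (underlying A) (g x))"

text \<open>
  \<open>F\<close> is the set of fresh copies of the nodes in \<^term>\<open>ends A e - incoming A e\<close>, with \<open>g2\<close> mapping
  each copy to its original. Copies are drawn from the node type itself, which must therefore be
  infinite for transitions not to be blocked.

  The active nodes after a transition are the untouched ones together with all nodes of the glued
  hyperedge, fresh or in \<open>P\<close>, that lie over an outgoing active node. If incoming and outgoing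
  nodes are disjoint, these are the untouched ones and the fresh copies of outgoing nodes.
  It is essential that a matched node over a node both incoming and outgoing stays active: if only
  fresh copies could be active, then, \<open>P\<close> being connected, all of \<open>P\<close> would have been created in
  one earlier transition. The hyperedges used would then form a tree decomposition, of bounded
  width, of the assembled graph, and no automaton could accept all square pictures.
\<close>

fun sa_step ::
    "'a set \<Rightarrow> ('n, 'e, 'a) sa_automaton \<Rightarrow>
     ('n, 'a) configuration \<Rightarrow> ('n, 'a) configuration \<Rightarrow> bool" where
  "sa_step \<Sigma> A (M1, Act1, g1) (M2, Act2, g2) \<longleftrightarrow>
     is_configuration \<Sigma> A (M1, Act1, g1) \<and> is_configuration \<Sigma> A (M2, Act2, g2) \<and>
     (\<exists>e\<in>hyperedges A. \<exists>P F.
        P \<noteq> {} \<and> P \<subseteq> Act1 \<and>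
        graph_iso g1 (induced M1 P) (induced (edge_graph A e) (incoming A e)) \<and>
        F \<inter> nodes M1 = {} \<and> bij_betw g2 F (ends A e - incoming A e) \<and>
        (\<forall>x\<in>nodes M1. g2 x = g1 x) \<and>
        nodes M2 = nodes M1 \<union> F \<and>
        vert M2 = vert M1 \<union>
          {(x, y). x \<in> P \<union> F \<and> y \<in> P \<union> F \<and> (g2 x, g2 y) \<in> vert (underlying A)} \<and>
        horiz M2 = horiz M1 \<union>
          {(x, y). x \<in> P \<union> F \<and> y \<in> P \<union> F \<and> (g2 x, g2 y) \<in> horiz (underlying A)} \<and>
        (\<forall>x\<in>nodes M2. lab M2 x = lab (underlying A) (g2 x)) \<and>
        Act2 = (Act1 - P) \<union> {x \<in> P \<union> F. g2 x \<in> outgoing A e})"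

definition initial_configuration ::
    "('n, 'e, 'a) sa_automaton \<Rightarrow> 'e \<Rightarrow> ('n, 'a) configuration" where
  "initial_configuration A e = (edge_graph A e, outgoing A e, restrict id (ends A e))"

definition graph_language ::
    "'a set \<Rightarrow> ('n, 'e, 'a) sa_automaton \<Rightarrow> ('n, 'a) ppgraph set" where
  "graph_language \<Sigma> A =
     {M. picture_graph \<Sigma> M \<and>
         (\<exists>e\<in>initials A. \<exists>g. (sa_step \<Sigma> A)\<^sup>*\<^sup>* (initial_configuration A e) (M, {}, g))}"

definition picture_language :: "('n, 'a) ppgraph set \<Rightarrow> 'a mat set" where
  "picture_language K = {p. \<exists>M\<in>K. represents M p}"

end

theory Submission
  imports Defs "HOL-Library.Nat_Bijection"
begin

text \<open>
  The underlying graph has a node for each tile together with coordinates modulo 3, with an edge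
  wherever colours match, so the map from an assembled picture to this graph is itself a candidate
  tiling: the colours of adjacent cells agree automatically. Only the border has to be controlled.
  A hyperedge may create a node only along with the
  northern and western neighbours demanded by the coloured edges of its tile, and may deactivate a
  node only if the demanded southern and eastern neighbours are present. When no active node is
  left, every coloured edge leads to a neighbour, so the border is uncoloured. Conversely, a tiled
  picture is assembled along down-closed sets of positions: the cell \<open>(i, j)\<close> is glued to
  \<open>(i - 1, j - 1)\<close>, \<open>(i - 1, j)\<close> and \<open>(i, j - 1)\<close>, which are still active and
  form a connected path.
\<close>

section \<open>Connectivity from a root, and residues modulo 3\<close>

text \<open>Induction on \<open>a + b\<close>: moving up while \<open>r < a\<close> and left while
  \<open>c < b\<close> stays inside \<open>T\<close> and follows edges, so every node is linked to
  \<open>\<kappa> (r, c)\<close>. Blocks and down-closed sets have this shape; \<open>T\<close> may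
  be empty, as happens for the incoming nodes at the first cell.\<close>

lemma connected_graph_rooted:
  fixes \<kappa> :: "nat \<times> nat \<Rightarrow> 'n"
  assumes nodes: "nodes G = \<kappa> ` T"
    and low: "\<And>a b. (a, b) \<in> T \<Longrightarrow> r \<le> a \<and> c \<le> b"
    and up: "\<And>a b. (a, b) \<in> T \<Longrightarrow> r < a \<Longrightarrow> (a - 1, b) \<in> T"
    and left: "\<And>a b. (a, b) \<in> T \<Longrightarrow> c < b \<Longrightarrow> (a, b - 1) \<in> T"
    and v: "\<And>a b. (a, b) \<in> T \<Longrightarrow> (Suc a, b) \<in> T \<Longrightarrow> (\<kappa> (a, b), \<kappa> (Suc a, b)) \<in> vert G"
    and h: "\<And>a b. (a, b) \<in> T \<Longrightarrow> (a, Suc b) \<in> T \<Longrightarrow> (\<kappa> (a, b), \<kappa> (a, Suc b)) \<in> horiz G"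
  shows "connected_graph G"
proof -
  define R where "R = vert G \<union> horiz G \<union> (vert G \<union> horiz G)\<inverse>"
  have root: "(\<kappa> (a, b), \<kappa> (r, c)) \<in> R\<^sup>*" if "(a, b) \<in> T" for a b
    using that
  proof (induction "a + b" arbitrary: a b rule: less_induct)
    case less
    consider "r < a" | "c < b" | "a = r" "b = c"
      using low[OF less.prems] by linarith
    then show ?case
    proof cases
      case 1
      have "(\<kappa> (a - 1, b), \<kappa> (r, c)) \<in> R\<^sup>*"
        using 1 up[OF less.prems] by (intro less.hyps) auto
      moreover have "(\<kappa> (a, b), \<kappa> (a - 1, b)) \<in> R"
        using v[OF up[OF less.prems 1]] less.prems 1 by (auto simp: R_def)
      ultimately show ?thesis by (rule converse_rtrancl_into_rtrancl[rotated])
    next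
      case 2
      have "(\<kappa> (a, b - 1), \<kappa> (r, c)) \<in> R\<^sup>*"
        using 2 left[OF less.prems] by (intro less.hyps) auto
      moreover have "(\<kappa> (a, b), \<kappa> (a, b - 1)) \<in> R"
        using h[OF left[OF less.prems 2]] less.prems 2 by (auto simp: R_def)
      ultimately show ?thesis by (rule converse_rtrancl_into_rtrancl[rotated])
    qed auto
  qed
  have "sym (R\<^sup>*)"
    by (rule sym_rtrancl) (auto simp: R_def sym_def)
  then have "(x, y) \<in> R\<^sup>*" if "x \<in> nodes G" "y \<in> nodes G" for x y
  proof -
    have "(x, \<kappa> (r, c)) \<in> R\<^sup>*" "(y, \<kappa> (r, c)) \<in> R\<^sup>*"
      using that root unfolding nodes by auto
    then show ?thesis
      using \<open>sym (R\<^sup>*)\<close> by (meson rtrancl_trans symD)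
  qed
  then show ?thesis
    by (auto simp: connected_graph_def R_def)
qed

lemma Suc_mod_3: "Suc n mod 3 \<noteq> n mod 3" by presburger
lemma Suc_Suc_mod_3: "Suc (Suc n) mod 3 \<noteq> n mod 3" by presburger
text \<open>For numbers at distance at most one, residues modulo 3 tell equality, successor and
  predecessor apart; modulo 2 the last two would coincide. The form
  \<open>Suc (a mod 3) mod 3\<close> is the one that occurs in the edges of
  \<open>tile_graph\<close>.\<close>

lemma near_mod_3:
  fixes a b :: nat
  assumes "a \<le> Suc b" "b \<le> Suc a"
  shows "b mod 3 = a mod 3 \<longleftrightarrow> b = a" and "b mod 3 = Suc (a mod 3) mod 3 \<longleftrightarrow> b = Suc a"
proof -
  consider "b = a" | "b = Suc a" | "a = Suc b"
    using assms by linarith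
  then have "(b mod 3 = a mod 3 \<longleftrightarrow> b = a) \<and> (b mod 3 = Suc a mod 3 \<longleftrightarrow> b = Suc a)"
  proof cases
    case 1
    then show ?thesis using Suc_mod_3[of a] by (metis n_not_Suc_n)
  next
    case 2
    then show ?thesis using Suc_mod_3[of a] by metis
  next
    case 3
    then show ?thesis using Suc_mod_3[of b] Suc_Suc_mod_3[of b] by (metis n_not_Suc_n)
  qed
  then show "b mod 3 = a mod 3 \<longleftrightarrow> b = a" and "b mod 3 = Suc (a mod 3) mod 3 \<longleftrightarrow> b = Suc a"
    unfolding mod_Suc_eq by blast+
qed

lemma induced_induced: "Y \<subseteq> X \<Longrightarrow> induced (induced G X) Y = induced G Y"
  by (auto simp: induced_def Int_absorb1)


lemma sa_stepI:
  assumes "is_configuration \<Sigma> A (M1, Act1, g1)" "is_configuration \<Sigma> A (M2, Act2, g2)"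
    and "e \<in> hyperedges A" "P \<noteq> {}" "P \<subseteq> Act1"
    and "graph_iso g1 (induced M1 P) (induced (edge_graph A e) (incoming A e))"
    and "F \<inter> nodes M1 = {}" "bij_betw g2 F (ends A e - incoming A e)"
    and "\<forall>x\<in>nodes M1. g2 x = g1 x" "nodes M2 = nodes M1 \<union> F"
    and "vert M2 = vert M1 \<union>
      {(x, y). x \<in> P \<union> F \<and> y \<in> P \<union> F \<and> (g2 x, g2 y) \<in> vert (underlying A)}"
    and "horiz M2 = horiz M1 \<union>
      {(x, y). x \<in> P \<union> F \<and> y \<in> P \<union> F \<and> (g2 x, g2 y) \<in> horiz (underlying A)}"
    and "\<forall>x\<in>nodes M2. lab M2 x = lab (underlying A) (g2 x)"
    and "Act2 = (Act1 - P) \<union> {x \<in> P \<union> F. g2 x \<in> outgoing A e}"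
  shows "sa_step \<Sigma> A (M1, Act1, g1) (M2, Act2, g2)"
  unfolding sa_step.simps by (intro conjI bexI[of _ e], rule assms, rule assms, rule exI[of _ P],
    rule exI[of _ F], intro conjI) (rule assms)+


section \<open>The automaton of a tile system\<close>

text \<open>Fresh copies are drawn from the node type, which must be infinite. Hence the finite set
  of tiles with residues is coded injectively by natural numbers.\<close>

locale coded_tiles =
  fixes \<Sigma> :: "'a set" and W :: "('a, 'c) wang_tiles"
    and \<nu> :: "('a, 'c) wang_tile \<times> nat \<times> nat \<Rightarrow> nat"
  assumes tile_system: "wang_tile_system \<Sigma> W"
    and inj_code: "inj_on \<nu> (tiles W \<times> {..<3} \<times> {..<3})"
begin

abbreviation cells :: "(('a, 'c) wang_tile \<times> nat \<times> nat) set" where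
  "cells \<equiv> tiles W \<times> {..<3} \<times> {..<3}"

definition tile_of :: "nat \<Rightarrow> ('a, 'c) wang_tile" where
  "tile_of x = fst (inv_into cells \<nu> x)"

text \<open>
  Coordinates modulo 3 recover the direction of the edge between two adjacent nodes, and separate
  the nodes of a block of size 2 by 2.
\<close>

definition tile_graph :: "(nat, 'a) ppgraph" where
  "tile_graph =
     \<lparr>nodes = \<nu> ` cells,
      vert = {(\<nu> (t, a, b), \<nu> (t', a', b')) | t a b t' a' b'.
        (t, a, b) \<in> cells \<and> (t', a', b') \<in> cells \<and>
        a' = Suc a mod 3 \<and> b' = b \<and> south t = north t' \<and> south t \<in> Some ` colours W},
      horiz = {(\<nu> (t, a, b), \<nu> (t', a', b')) | t a b t' a' b'.
        (t, a, b) \<in> cells \<and> (t', a', b') \<in> cells \<and>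
        a' = a \<and> b' = Suc b mod 3 \<and> east t = west t' \<and> east t \<in> Some ` colours W},
      lab = restrict (label \<circ> tile_of) (\<nu> ` cells)\<rparr>"

text \<open>
  All sound hyperedges are admitted at once, which saves listing the cases of interior, border and
  corner cells; those needed to assemble a picture are identified later.
\<close>

definition rules :: "(nat set \<times> nat set \<times> nat set) set" where
  "rules = {(U, Q1, Q2). U \<subseteq> nodes tile_graph \<and> Q1 \<subseteq> U \<and> Q2 \<subseteq> U \<and>
     connected_graph (induced tile_graph U) \<and> connected_graph (induced tile_graph Q1) \<and>
     (\<forall>x\<in>U - Q1.
        (north (tile_of x) \<noteq> None \<longrightarrow> (\<exists>y\<in>U. (y, x) \<in> vert tile_graph)) \<and>
        (west (tile_of x) \<noteq> None \<longrightarrow> (\<exists>y\<in>U. (y, x) \<in> horiz tile_graph))) \<and>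
     (\<forall>x\<in>U - Q2.
        (south (tile_of x) \<noteq> None \<longrightarrow> (\<exists>y\<in>U. (x, y) \<in> vert tile_graph)) \<and>
        (east (tile_of x) \<noteq> None \<longrightarrow> (\<exists>y\<in>U. (x, y) \<in> horiz tile_graph)))}"

text \<open>Numbering the rules lets a hyperedge be an index, so that copies of one rule can be
  distinct hyperedges.\<close>

definition rule_list :: "(nat set \<times> nat set \<times> nat set) list" where
  "rule_list = (SOME rs. set rs = rules)"

text \<open>Every rule occurs twice, so that all nodes of a hyperedge are intersection nodes.\<close>

definition automaton :: "(nat, nat, 'a) sa_automaton" where
  "automaton =
     \<lparr>hyperedges = {..<2 * length rule_list},
      ends = \<lambda>e. fst (rule_list ! (e div 2)),
      active = \<lambda>e. snd (rule_list ! (e div 2)),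
      underlying = tile_graph,
      initials = {e. e < 2 * length rule_list \<and> fst (snd (rule_list ! (e div 2))) = {}}\<rparr>"

lemma automaton_simps [simp]:
  "underlying automaton = tile_graph"
  "hyperedges automaton = {..<2 * length rule_list}"
  by (simp_all add: automaton_def)

section \<open>Nodes and edges of the tile graph\<close>

lemma finite_cells: "finite cells"
  using tile_system by (simp add: wang_tile_system_def)

lemma tile_of_code [simp]: "(t, a, b) \<in> cells \<Longrightarrow> tile_of (\<nu> (t, a, b)) = t"
  using inv_into_f_f[OF inj_code, of "(t, a, b)"] by (simp add: tile_of_def)

lemma code_eq_iff:
  "\<lbrakk>t \<in> tiles W; a < 3; b < 3; t' \<in> tiles W; a' < 3; b' < 3\<rbrakk>
    \<Longrightarrow> \<nu> (t, a, b) = \<nu> (t', a', b') \<longleftrightarrow> t = t' \<and> a = a' \<and> b = b'"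
  using inj_on_eq_iff[OF inj_code, of "(t, a, b)" "(t', a', b')"] by simp

lemma nodes_tile_graph: "nodes tile_graph = \<nu> ` cells"
  by (simp add: tile_graph_def)

text \<open>As \<open>\<nu>\<close> is injective on \<open>cells\<close>, the endpoints determine
  tiles and residues, and the existential quantifiers in the edge set collapse.\<close>

lemma vert_tile_graph_iff:
  assumes "(t, a, b) \<in> cells" "(t', a', b') \<in> cells"
  shows "(\<nu> (t, a, b), \<nu> (t', a', b')) \<in> vert tile_graph \<longleftrightarrow>
    a' = Suc a mod 3 \<and> b' = b \<and> south t = north t' \<and> south t \<in> Some ` colours W"
proof
  assume "(\<nu> (t, a, b), \<nu> (t', a', b')) \<in> vert tile_graph"
  then obtain s c d s' c' d' where "\<nu> (t, a, b) = \<nu> (s, c, d)" "\<nu> (t', a', b') = \<nu> (s', c', d')"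
    "(s, c, d) \<in> cells" "(s', c', d') \<in> cells"
    and *: "c' = Suc c mod 3 \<and> d' = d \<and> south s = north s' \<and> south s \<in> Some ` colours W"
    unfolding tile_graph_def ppgraph.select_convs mem_Collect_eq prod.inject by blast
  with assms have "t = s" "a = c" "b = d" "t' = s'" "a' = c'" "b' = d'"
    by (simp_all add: code_eq_iff)
  with * show "a' = Suc a mod 3 \<and> b' = b \<and> south t = north t' \<and> south t \<in> Some ` colours W" by metis
next
  assume "a' = Suc a mod 3 \<and> b' = b \<and> south t = north t' \<and> south t \<in> Some ` colours W"
  with assms show "(\<nu> (t, a, b), \<nu> (t', a', b')) \<in> vert tile_graph"
    unfolding tile_graph_def ppgraph.select_convs by blast
qed

lemma horiz_tile_graph_iff:
  assumes "(t, a, b) \<in> cells" "(t', a', b') \<in> cells"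
  shows "(\<nu> (t, a, b), \<nu> (t', a', b')) \<in> horiz tile_graph \<longleftrightarrow>
    a' = a \<and> b' = Suc b mod 3 \<and> east t = west t' \<and> east t \<in> Some ` colours W"
proof
  assume "(\<nu> (t, a, b), \<nu> (t', a', b')) \<in> horiz tile_graph"
  then obtain s c d s' c' d' where "\<nu> (t, a, b) = \<nu> (s, c, d)" "\<nu> (t', a', b') = \<nu> (s', c', d')"
    "(s, c, d) \<in> cells" "(s', c', d') \<in> cells"
    and *: "c' = c \<and> d' = Suc d mod 3 \<and> east s = west s' \<and> east s \<in> Some ` colours W"
    unfolding tile_graph_def ppgraph.select_convs mem_Collect_eq prod.inject by blast
  with assms have "t = s" "a = c" "b = d" "t' = s'" "a' = c'" "b' = d'"
    by (simp_all add: code_eq_iff)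
  with * show "a' = a \<and> b' = Suc b mod 3 \<and> east t = west t' \<and> east t \<in> Some ` colours W" by metis
next
  assume "a' = a \<and> b' = Suc b mod 3 \<and> east t = west t' \<and> east t \<in> Some ` colours W"
  with assms show "(\<nu> (t, a, b), \<nu> (t', a', b')) \<in> horiz tile_graph"
    unfolding tile_graph_def ppgraph.select_convs by blast
qed

lemma tile_graph_nodeE:
  assumes "x \<in> nodes tile_graph"
  obtains t a b where "x = \<nu> (t, a, b)" "(t, a, b) \<in> cells"
  using assms unfolding nodes_tile_graph by blast

lemma edges_subset_nodes:
  "vert tile_graph \<subseteq> nodes tile_graph \<times> nodes tile_graph"
  "horiz tile_graph \<subseteq> nodes tile_graph \<times> nodes tile_graph"
  by (auto simp: tile_graph_def)

lemma tile_graph_edgeE: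
  assumes "(x, y) \<in> vert tile_graph \<union> horiz tile_graph"
  obtains t a b t' a' b' where "x = \<nu> (t, a, b)" "y = \<nu> (t', a', b')"
    "(t, a, b) \<in> cells" "(t', a', b') \<in> cells"
proof -
  have "x \<in> nodes tile_graph" "y \<in> nodes tile_graph"
    using assms edges_subset_nodes by auto
  then show thesis
    by (elim tile_graph_nodeE) (rule that)
qed

lemma vert_tile_graphD:
  assumes "(x, y) \<in> vert tile_graph"
  shows "south (tile_of x) = north (tile_of y) \<and> south (tile_of x) \<in> Some ` colours W"
proof -
  obtain t a b t' a' b' where xy: "x = \<nu> (t, a, b)" "y = \<nu> (t', a', b')"
    and c: "(t, a, b) \<in> cells" "(t', a', b') \<in> cells"
    by (rule tile_graph_edgeE[OF UnI1[OF assms]])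
  show ?thesis
    using assms unfolding xy vert_tile_graph_iff[OF c] tile_of_code[OF c(1)] tile_of_code[OF c(2)]
    by blast
qed

lemma horiz_tile_graphD:
  assumes "(x, y) \<in> horiz tile_graph"
  shows "east (tile_of x) = west (tile_of y) \<and> east (tile_of x) \<in> Some ` colours W"
proof -
  obtain t a b t' a' b' where xy: "x = \<nu> (t, a, b)" "y = \<nu> (t', a', b')"
    and c: "(t, a, b) \<in> cells" "(t', a', b') \<in> cells"
    by (rule tile_graph_edgeE[OF UnI2[OF assms]])
  show ?thesis
    using assms unfolding xy horiz_tile_graph_iff[OF c] tile_of_code[OF c(1)] tile_of_code[OF c(2)]
    by blast
qed

lemma label_in: "x \<in> nodes tile_graph \<Longrightarrow> tile_of x \<in> tiles W \<and> label (tile_of x) \<in> \<Sigma>"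
  using tile_system by (auto simp: nodes_tile_graph wang_tile_system_def)

lemma lab_tile_graph: "x \<in> nodes tile_graph \<Longrightarrow> lab tile_graph x = label (tile_of x)"
  by (simp add: tile_graph_def)

text \<open>The point to check is disjointness of the edge sets: a vertical edge changes the row
  residue, which a horizontal edge preserves.\<close>

lemma pseudo_tile_graph: "pseudo_picture_graph \<Sigma> tile_graph"
proof -
  have "(x, y) \<notin> horiz tile_graph" if xyv: "(x, y) \<in> vert tile_graph" for x y
  proof -
    obtain t a b t' a' b' where xy: "x = \<nu> (t, a, b)" "y = \<nu> (t', a', b')"
      and c: "(t, a, b) \<in> cells" "(t', a', b') \<in> cells"
      by (rule tile_graph_edgeE[OF UnI1[OF xyv]])
    have "a' = Suc a mod 3" "a < 3"
      using xyv c unfolding xy vert_tile_graph_iff[OF c] by auto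
    then have "a' \<noteq> a" by presburger
    then show ?thesis unfolding xy horiz_tile_graph_iff[OF c] by simp
  qed
  moreover have "lab tile_graph \<in> nodes tile_graph \<rightarrow>\<^sub>E \<Sigma>"
    using label_in by (auto simp: lab_tile_graph) (simp add: tile_graph_def)
  ultimately show ?thesis
    using edges_subset_nodes finite_cells
    by (auto simp: pseudo_picture_graph_def nodes_tile_graph)
qed

section \<open>Rules and hyperedges\<close>

lemma set_rule_list: "set rule_list = rules"
proof -
  \<comment> \<open>Rules are triples of subsets of a finite set; finiteness is what makes the
    choice in \<open>rule_list\<close> succeed.\<close>
  have "rules \<subseteq> Pow (nodes tile_graph) \<times> Pow (nodes tile_graph) \<times> Pow (nodes tile_graph)"
    by (auto simp: rules_def)
  then have "finite rules"
    using finite_cells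
    by (meson finite_Pow_iff finite_SigmaI finite_subset pseudo_picture_graph_def pseudo_tile_graph)
  then show ?thesis
    unfolding rule_list_def by (metis (mono_tags) finite_list someI_ex)
qed

lemma hyperedge_rule:
  "e \<in> hyperedges automaton
    \<Longrightarrow> (ends automaton e, incoming automaton e, outgoing automaton e) \<in> rules"
  by (simp add: automaton_def less_mult_imp_div_less mult.commute flip: set_rule_list)

lemma rule_hyperedge:
  assumes "(U, Q1, Q2) \<in> rules"
  obtains e where "e \<in> hyperedges automaton" "ends automaton e = U"
    "incoming automaton e = Q1" "outgoing automaton e = Q2"
proof -
  obtain k where "k < length rule_list" "rule_list ! k = (U, Q1, Q2)"
    using assms by (metis in_set_conv_nth set_rule_list)
  \<comment> \<open>Rule \<open>k\<close> sits at the indices \<open>2 * k\<close> and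
    \<open>2 * k + 1\<close>; either would do.\<close>
  then show thesis
    by (intro that[of "2 * k"]) (auto simp: automaton_def)
qed

lemma initials_iff:
  "e \<in> initials automaton \<longleftrightarrow> e \<in> hyperedges automaton \<and> incoming automaton e = {}"
  by (simp add: automaton_def)

text \<open>The twin index \<open>e'\<close>, differing from \<open>e\<close> only in the last bit,
  carries the same rule and so shares all nodes with \<open>e\<close>. It is in range because the
  number of indices is even.\<close>

lemma intersection_nodes_automaton:
  assumes "e \<in> hyperedges automaton"
  shows "ends automaton e \<subseteq> intersection_nodes automaton e"
proof -
  define e' where "e' = (if even e then Suc e else e - 1)"
  have "e' \<noteq> e" "e' div 2 = e div 2"
    by (auto simp: e'_def elim!: oddE)
  moreover have "e' \<in> hyperedges automaton"
    using assms by (auto simp: e'_def elim!: evenE)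
  moreover have "ends automaton e' = ends automaton e"
    using \<open>e' div 2 = e div 2\<close> by (simp add: automaton_def)
  moreover have "ends automaton e \<subseteq> nodes tile_graph"
    using hyperedge_rule[OF assms] by (auto simp: rules_def)
  ultimately show ?thesis
    unfolding intersection_nodes_def by auto
qed

lemma sa_automaton: "sa_hypergraph_automaton \<Sigma> automaton"
proof -
  have "ends automaton e \<subseteq> nodes tile_graph \<and>
        incoming automaton e \<subseteq> intersection_nodes automaton e \<and>
        outgoing automaton e \<subseteq> intersection_nodes automaton e \<and>
        connected_graph (edge_graph automaton e) \<and>
        connected_graph (induced (edge_graph automaton e) (incoming automaton e))"
    if e: "e \<in> hyperedges automaton" for e
    using hyperedge_rule[OF e] intersection_nodes_automaton[OF e]
    by (auto simp: rules_def edge_graph_def induced_induced)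
  then show ?thesis
    using pseudo_tile_graph tile_system
    by (auto simp: sa_hypergraph_automaton_def wang_tile_system_def initials_iff)
qed


section \<open>Accepted pictures have a tiling\<close>

text \<open>The invariant of all runs. Active nodes are exempt from the southern and eastern
  demands, since those neighbours may still be glued on; the exemption disappears once no node is
  active.\<close>

fun consistent :: "(nat, 'a) configuration \<Rightarrow> bool" where
  "consistent (M, Act, g) \<longleftrightarrow>
     g ` nodes M \<subseteq> nodes tile_graph \<and> (\<forall>x\<in>nodes M. lab M x = lab tile_graph (g x)) \<and>
     (\<forall>(x, y)\<in>vert M. (g x, g y) \<in> vert tile_graph) \<and>
     (\<forall>(x, y)\<in>horiz M. (g x, g y) \<in> horiz tile_graph) \<and>
     (\<forall>x\<in>nodes M. (north (tile_of (g x)) \<noteq> None \<longrightarrow> (\<exists>y. (y, x) \<in> vert M)) \<and>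
        (west (tile_of (g x)) \<noteq> None \<longrightarrow> (\<exists>y. (y, x) \<in> horiz M))) \<and>
     (\<forall>x\<in>nodes M - Act. (south (tile_of (g x)) \<noteq> None \<longrightarrow> (\<exists>y. (x, y) \<in> vert M)) \<and>
        (east (tile_of (g x)) \<noteq> None \<longrightarrow> (\<exists>y. (x, y) \<in> horiz M)))"

lemma consistentD:
  assumes "consistent (M, Act, g)"
  shows "x \<in> nodes M \<Longrightarrow> g x \<in> nodes tile_graph"
    and "x \<in> nodes M \<Longrightarrow> lab M x = lab tile_graph (g x)"
    and "(x, y) \<in> vert M \<Longrightarrow> (g x, g y) \<in> vert tile_graph"
    and "(x, y) \<in> horiz M \<Longrightarrow> (g x, g y) \<in> horiz tile_graph"
    and "\<lbrakk>x \<in> nodes M; north (tile_of (g x)) \<noteq> None\<rbrakk> \<Longrightarrow> \<exists>y. (y, x) \<in> vert M"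
    and "\<lbrakk>x \<in> nodes M; west (tile_of (g x)) \<noteq> None\<rbrakk> \<Longrightarrow> \<exists>y. (y, x) \<in> horiz M"
    and "\<lbrakk>x \<in> nodes M; x \<notin> Act; south (tile_of (g x)) \<noteq> None\<rbrakk> \<Longrightarrow> \<exists>y. (x, y) \<in> vert M"
    and "\<lbrakk>x \<in> nodes M; x \<notin> Act; east (tile_of (g x)) \<noteq> None\<rbrakk> \<Longrightarrow> \<exists>y. (x, y) \<in> horiz M"
  using assms unfolding consistent.simps by blast+

text \<open>Without incoming nodes every node counts as created, so the demands of
  \<open>rules\<close> to the north and west cover the whole hyperedge.\<close>

lemma consistent_initial:
  assumes "e \<in> initials automaton"
  shows "consistent (initial_configuration automaton e)"
proof -
  define U Q where "U = ends automaton e" and "Q = outgoing automaton e"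
  have "(U, {}, Q) \<in> rules"
    using assms hyperedge_rule[of e] by (auto simp: initials_iff U_def Q_def)
  then have "U \<subseteq> nodes tile_graph"
    and "\<forall>x\<in>U.
      (north (tile_of x) \<noteq> None \<longrightarrow> (\<exists>y\<in>U. (y, x) \<in> vert tile_graph)) \<and>
      (west (tile_of x) \<noteq> None \<longrightarrow> (\<exists>y\<in>U. (y, x) \<in> horiz tile_graph))"
    and "\<forall>x\<in>U - Q.
      (south (tile_of x) \<noteq> None \<longrightarrow> (\<exists>y\<in>U. (x, y) \<in> vert tile_graph)) \<and>
      (east (tile_of x) \<noteq> None \<longrightarrow> (\<exists>y\<in>U. (x, y) \<in> horiz tile_graph))"
    by (simp_all add: rules_def)
  then have "consistent (induced tile_graph U, Q, restrict id U)"
    by (auto simp: induced_def)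
  then show ?thesis
    by (simp add: initial_configuration_def edge_graph_def U_def Q_def)
qed

text \<open>Edges are only added, so neighbours found earlier persist. The glued part
  \<open>P \<union> F\<close> is mapped onto the nodes of the hyperedge, so each neighbour promised
  by the rule has a preimage there, and gluing adds the edge to it.\<close>

lemma consistent_step:
  assumes step: "sa_step \<Sigma> automaton (M1, Act1, g1) (M2, Act2, g2)"
    and cons: "consistent (M1, Act1, g1)"
  shows "consistent (M2, Act2, g2)"
proof -
  obtain e P F where e: "e \<in> hyperedges automaton" and P: "P \<subseteq> Act1"
    and iso: "graph_iso g1 (induced M1 P) (induced (edge_graph automaton e) (incoming automaton e))"
    and F: "F \<inter> nodes M1 = {}" "bij_betw g2 F (ends automaton e - incoming automaton e)"
    and g2: "\<forall>x\<in>nodes M1. g2 x = g1 x"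
    and n2: "nodes M2 = nodes M1 \<union> F"
    and v2: "vert M2 = vert M1 \<union>
          {(x, y). x \<in> P \<union> F \<and> y \<in> P \<union> F \<and> (g2 x, g2 y) \<in> vert tile_graph}"
    and h2: "horiz M2 = horiz M1 \<union>
          {(x, y). x \<in> P \<union> F \<and> y \<in> P \<union> F \<and> (g2 x, g2 y) \<in> horiz tile_graph}"
    and l2: "\<forall>x\<in>nodes M2. lab M2 x = lab tile_graph (g2 x)"
    and a2: "Act2 = (Act1 - P) \<union> {x \<in> P \<union> F. g2 x \<in> outgoing automaton e}"
    and conf: "is_configuration \<Sigma> automaton (M1, Act1, g1)"
      "is_configuration \<Sigma> automaton (M2, Act2, g2)"
    using step[unfolded sa_step.simps automaton_simps(1)]
    by (elim conjE bexE exE) (rule that; assumption)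
  have sub: "P \<subseteq> nodes M1" "vert M1 \<subseteq> nodes M1 \<times> nodes M1" "horiz M1 \<subseteq> nodes M1 \<times> nodes M1"
    using P conf(1) by (auto simp: subgrid_def pseudo_picture_graph_def)
  define U Q1 Q2 where "U = ends automaton e" and "Q1 = incoming automaton e"
    and "Q2 = outgoing automaton e"
  have rule: "(U, Q1, Q2) \<in> rules"
    using hyperedge_rule[OF e] by (simp add: U_def Q1_def Q2_def)
  have "g1 ` P = Q1"
    using iso by (simp add: graph_iso_def induced_def bij_betw_def Q1_def)
  then have gP: "g2 ` P = Q1"
    using g2 sub(1) by (metis (no_types, lifting) image_cong subsetD)
  have gF: "g2 ` F = U - Q1"
    using F(2) by (simp add: bij_betw_def U_def Q1_def)
  have "Q1 \<subseteq> U" using rule by (simp add: rules_def)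
  then have onto: "\<exists>x\<in>P \<union> F. g2 x = u" if "u \<in> U" for u
    using that gP gF by (metis Diff_partition UnI1 UnI2 Un_iff imageE)
  have into: "g2 x \<in> U" if "x \<in> P \<union> F" for x
    using that gP gF \<open>Q1 \<subseteq> U\<close> by blast
  have g2n: "g2 ` nodes M2 \<subseteq> nodes tile_graph"
    using conf(2) by auto
  have cr: "(north (tile_of (g2 x)) \<noteq> None \<longrightarrow> (\<exists>y. (y, x) \<in> vert M2)) \<and>
        (west (tile_of (g2 x)) \<noteq> None \<longrightarrow> (\<exists>y. (y, x) \<in> horiz M2))" if x: "x \<in> nodes M2" for x
  proof (cases "x \<in> F")
    case True
    then have "g2 x \<in> U - Q1" using gF by blast
    then have "(north (tile_of (g2 x)) \<noteq> None \<longrightarrow> (\<exists>y\<in>U. (y, g2 x) \<in> vert tile_graph)) \<and>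
        (west (tile_of (g2 x)) \<noteq> None \<longrightarrow> (\<exists>y\<in>U. (y, g2 x) \<in> horiz tile_graph))"
      using rule by (simp add: rules_def)
    then show ?thesis using onto True unfolding v2 h2 by blast
  next
    case False
    then have "x \<in> nodes M1" "g2 x = g1 x" using x n2 g2 by auto
    then show ?thesis using consistentD(5,6)[OF cons, of x] unfolding v2 h2 by auto
  qed
  have de: "(south (tile_of (g2 x)) \<noteq> None \<longrightarrow> (\<exists>y. (x, y) \<in> vert M2)) \<and>
        (east (tile_of (g2 x)) \<noteq> None \<longrightarrow> (\<exists>y. (x, y) \<in> horiz M2))"
    if x: "x \<in> nodes M2 - Act2" for x
  proof (cases "x \<in> P \<union> F")
    case True
    then have "g2 x \<in> U - Q2" using into x a2 by (auto simp: Q2_def)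
    then have "(south (tile_of (g2 x)) \<noteq> None \<longrightarrow> (\<exists>y\<in>U. (g2 x, y) \<in> vert tile_graph)) \<and>
        (east (tile_of (g2 x)) \<noteq> None \<longrightarrow> (\<exists>y\<in>U. (g2 x, y) \<in> horiz tile_graph))"
      using rule by (simp add: rules_def)
    then show ?thesis using onto True unfolding v2 h2 by blast
  next
    case False
    \<comment> \<open>\<open>Act1 - P\<close> stays active, so a node outside the glued part that is
      inactive now was inactive before.\<close>
    then have "x \<in> nodes M1 - Act1" "g2 x = g1 x" using x n2 g2 a2 by auto
    then show ?thesis using consistentD(7,8)[OF cons, of x] unfolding v2 h2 by auto
  qed
  have "(g2 x, g2 y) \<in> vert tile_graph" if "(x, y) \<in> vert M2" for x y
    using that consistentD(3)[OF cons, of x y] g2 sub(2) unfolding v2 by auto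
  moreover have "(g2 x, g2 y) \<in> horiz tile_graph" if "(x, y) \<in> horiz M2" for x y
    using that consistentD(4)[OF cons, of x y] g2 sub(3) unfolding h2 by auto
  ultimately show ?thesis
    unfolding consistent.simps using cr de g2n l2 by (intro conjI) blast+
qed

lemma consistent_steps:
  assumes "(sa_step \<Sigma> automaton)\<^sup>*\<^sup>* C D" "consistent C"
  shows "consistent D"
  using assms
proof (induction rule: rtranclp_induct)
  case (step D E)
  obtain M1 A1 g1 M2 A2 g2 where "D = (M1, A1, g1)" "E = (M2, A2, g2)"
    by (metis prod_cases3)
  with step show ?case using consistent_step by blast
qed

text \<open>Each tile is read off the node at its position, so colours agree along edges. At the
  border the invariant is used contrapositively: a coloured outer edge would demand a neighbour
  outside the grid.\<close>

lemma consistent_tiling: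
  assumes cons: "consistent (M, {}, g)" and M: "picture_graph \<Sigma> M" and p: "represents M p"
  shows "p \<in> wang_language \<Sigma> W"
proof -
  obtain n m f where nm: "n > 0" "m > 0" and f: "grid_coords M n m f"
    and p_eq: "p = mat n m (\<lambda>ij. lab M (inv_into (nodes M) f ij))"
    using p by (auto simp: represents_def)
  have bij: "bij_betw f (nodes M) ({..<n} \<times> {..<m})"
    and v: "\<And>x y. x \<in> nodes M \<Longrightarrow> y \<in> nodes M \<Longrightarrow>
          (x, y) \<in> vert M \<longleftrightarrow> f y = (fst (f x) + 1, snd (f x))"
    and h: "\<And>x y. x \<in> nodes M \<Longrightarrow> y \<in> nodes M \<Longrightarrow>
          (x, y) \<in> horiz M \<longleftrightarrow> f y = (fst (f x), snd (f x) + 1)"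
    using f by (auto simp: grid_coords_def)
  have sub: "vert M \<subseteq> nodes M \<times> nodes M" "horiz M \<subseteq> nodes M \<times> nodes M"
    and labM: "\<And>x. x \<in> nodes M \<Longrightarrow> lab M x \<in> \<Sigma>"
    using M by (auto simp: picture_graph_def pseudo_picture_graph_def)
  define \<xi> where "\<xi> = inv_into (nodes M) f"
  have \<xi>: "\<xi> (i, j) \<in> nodes M" "f (\<xi> (i, j)) = (i, j)" if "i < n" "j < m" for i j
    using that bij unfolding \<xi>_def
    by (auto simp: bij_betw_def inv_into_into f_inv_into_f)
  have range: "fst (f x) < n" "snd (f x) < m" if "x \<in> nodes M" for x
    using bij_betwE[OF bij] that by auto
  define \<mu> where "\<mu> = (\<lambda>ij. tile_of (g (\<xi> ij)))"
  have gn: "g x \<in> nodes tile_graph" "lab M x = label (tile_of (g x))" if "x \<in> nodes M" for x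
    using consistentD(1,2)[OF cons that] lab_tile_graph by auto
  have "wang_tiling W p \<mu>"
    unfolding wang_tiling_def
  proof (intro conjI allI impI)
    fix i j assume ij: "i < dim_row p" "j < dim_col p"
    then have "i < n" "j < m" by (auto simp: p_eq)
    then show "\<mu> (i, j) \<in> tiles W" "label (\<mu> (i, j)) = p $$ (i, j)"
      using \<xi>[of i j] gn[of "\<xi> (i, j)"] label_in by (auto simp: \<mu>_def p_eq \<xi>_def)
  next
    fix i j assume "i + 1 < dim_row p \<and> j < dim_col p"
    then have "i + 1 < n" "j < m" by (auto simp: p_eq)
    then have "(\<xi> (i, j), \<xi> (i + 1, j)) \<in> vert M"
      using v \<xi>[of i j] \<xi>[of "i + 1" j] by simp
    from vert_tile_graphD[OF consistentD(3)[OF cons this]]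
    show "south (\<mu> (i, j)) = north (\<mu> (i + 1, j))" "south (\<mu> (i, j)) \<in> Some ` colours W"
      unfolding \<mu>_def by blast+
  next
    fix i j assume "i < dim_row p \<and> j + 1 < dim_col p"
    then have "i < n" "j + 1 < m" by (auto simp: p_eq)
    then have "(\<xi> (i, j), \<xi> (i, j + 1)) \<in> horiz M"
      using h \<xi>[of i j] \<xi>[of i "j + 1"] by simp
    from horiz_tile_graphD[OF consistentD(4)[OF cons this]]
    show "east (\<mu> (i, j)) = west (\<mu> (i, j + 1))" "east (\<mu> (i, j)) \<in> Some ` colours W"
      unfolding \<mu>_def by blast+
  next
    fix j assume "j < dim_col p"
    then have j: "0 < n" "j < m" "n - 1 < n" using nm by (auto simp: p_eq)
    have "(y, \<xi> (0, j)) \<notin> vert M" for y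
    proof
      assume "(y, \<xi> (0, j)) \<in> vert M"
      then have "f (\<xi> (0, j)) = (fst (f y) + 1, snd (f y))"
        using v sub by blast
      then show False using \<xi>(2)[OF j(1,2)] by simp
    qed
    then show "north (\<mu> (0, j)) = None"
      using consistentD(5)[OF cons \<xi>(1)[OF j(1,2)]] unfolding \<mu>_def by blast
    have "(\<xi> (n - 1, j), y) \<notin> vert M" for y
    proof
      assume *: "(\<xi> (n - 1, j), y) \<in> vert M"
      then have "f y = (fst (f (\<xi> (n - 1, j))) + 1, snd (f (\<xi> (n - 1, j))))"
        using v sub by blast
      then show False using \<xi>(2)[OF j(3,2)] range(1)[of y] * sub by auto
    qed
    \<comment> \<open>The southern demand applies to every node here because the set of active nodes
      is empty.\<close>
    then show "south (\<mu> (dim_row p - 1, j)) = None"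
      using consistentD(7)[OF cons \<xi>(1)[OF j(3,2)]] unfolding \<mu>_def p_eq dim_row_mat by blast
  next
    fix i assume "i < dim_row p"
    then have i: "i < n" "0 < m" "m - 1 < m" using nm by (auto simp: p_eq)
    have "(y, \<xi> (i, 0)) \<notin> horiz M" for y
    proof
      assume "(y, \<xi> (i, 0)) \<in> horiz M"
      then have "f (\<xi> (i, 0)) = (fst (f y), snd (f y) + 1)"
        using h sub by blast
      then show False using \<xi>(2)[OF i(1,2)] by simp
    qed
    then show "west (\<mu> (i, 0)) = None"
      using consistentD(6)[OF cons \<xi>(1)[OF i(1,2)]] unfolding \<mu>_def by blast
    have "(\<xi> (i, m - 1), y) \<notin> horiz M" for y
    proof
      assume *: "(\<xi> (i, m - 1), y) \<in> horiz M"
      then have "f y = (fst (f (\<xi> (i, m - 1))), snd (f (\<xi> (i, m - 1))) + 1)"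
        using h sub by blast
      then show False using \<xi>(2)[OF i(1,3)] range(2)[of y] * sub by auto
    qed
    then show "east (\<mu> (i, dim_col p - 1)) = None"
      using consistentD(8)[OF cons \<xi>(1)[OF i(1,3)]] unfolding \<mu>_def p_eq dim_col_mat by blast
  qed
  moreover have "p \<in> pictures \<Sigma>"
    using nm labM \<xi>(1) by (auto simp: pictures_def p_eq elements_mat_def \<xi>_def)
  ultimately show ?thesis by (auto simp: wang_language_def)
qed

lemma accepted_subset: "picture_language (graph_language \<Sigma> automaton) \<subseteq> wang_language \<Sigma> W"
proof
  fix p assume "p \<in> picture_language (graph_language \<Sigma> automaton)"
  then obtain M e g where "picture_graph \<Sigma> M" "represents M p" "e \<in> initials automaton"
    "(sa_step \<Sigma> automaton)\<^sup>*\<^sup>* (initial_configuration automaton e) (M, {}, g)"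
    unfolding picture_language_def graph_language_def by blast
  then show "p \<in> wang_language \<Sigma> W"
    using consistent_tiling consistent_steps consistent_initial by blast
qed

end


section \<open>Assembling a tiled picture\<close>

locale tiled_picture = coded_tiles \<Sigma> W \<nu>
  for \<Sigma> :: "'a set" and W :: "('a, 'c) wang_tiles"
    and \<nu> :: "('a, 'c) wang_tile \<times> nat \<times> nat \<Rightarrow> nat" +
  fixes p :: "'a mat" and m :: "nat \<times> nat \<Rightarrow> ('a, 'c) wang_tile"
  assumes picture: "p \<in> pictures \<Sigma>" and tiling: "wang_tiling W p m"
begin

abbreviation grid :: "(nat \<times> nat) set" where
  "grid \<equiv> {..<dim_row p} \<times> {..<dim_col p}"

fun state :: "nat \<times> nat \<Rightarrow> nat" where
  "state (i, j) = \<nu> (m (i, j), i mod 3, j mod 3)"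

declare state.simps [simp del]

text \<open>Truncated subtraction shrinks the block in row 0 or column 0, which covers border cells
  without separate cases.\<close>

definition block :: "nat \<Rightarrow> nat \<Rightarrow> (nat \<times> nat) set" where
  "block i j = {i - 1..i} \<times> {j - 1..j}"

text \<open>The position whose filling completes the neighbourhood of a given one.\<close>

fun corner :: "nat \<times> nat \<Rightarrow> nat \<times> nat" where
  "corner (i, j) = (min (Suc i) (dim_row p - 1), min (Suc j) (dim_col p - 1))"

text \<open>The cells kept active. If a down-closed \<open>S\<close> contains the corner of a cell,
  it contains the southern and eastern neighbours inside the grid. Waiting for the diagonal cell
  keeps the cell available to connect these two neighbours when the diagonal is glued.\<close>

definition frontier :: "(nat \<times> nat) set \<Rightarrow> (nat \<times> nat) set" where
  "frontier S = {q \<in> S. corner q \<notin> S}"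

text \<open>
  In an initial configuration, the node over a node of the automaton is that node itself, whence
  the offset.
\<close>

definition place :: "nat \<times> nat \<Rightarrow> nat" where
  "place q = state (0, 0) + prod_encode q"

definition position :: "nat \<Rightarrow> nat \<times> nat" where
  "position = inv_into UNIV place"

definition partial :: "(nat \<times> nat) set \<Rightarrow> (nat, 'a) ppgraph" where
  "partial S =
     \<lparr>nodes = place ` S,
      vert = {(place (i, j), place (Suc i, j)) | i j. (i, j) \<in> S \<and> (Suc i, j) \<in> S},
      horiz = {(place (i, j), place (i, Suc j)) | i j. (i, j) \<in> S \<and> (i, Suc j) \<in> S},
      lab = restrict (\<lambda>x. p $$ position x) (place ` S)\<rparr>"

definition config :: "(nat \<times> nat) set \<Rightarrow> (nat, 'a) configuration" where
  "config S = (partial S, place ` frontier S, restrict (state \<circ> position) (place ` S))"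

definition down_closed :: "(nat \<times> nat) set \<Rightarrow> bool" where
  "down_closed S \<longleftrightarrow> (\<forall>i j i' j'. (i, j) \<in> S \<longrightarrow> i' \<le> i \<longrightarrow> j' \<le> j \<longrightarrow> (i', j') \<in> S)"

section \<open>States of nearby positions\<close>

lemma down_closedD: "\<lbrakk>down_closed S; (i, j) \<in> S; i' \<le> i; j' \<le> j\<rbrakk> \<Longrightarrow> (i', j') \<in> S"
  unfolding down_closed_def by blast

lemma dims_pos: "0 < dim_row p" "0 < dim_col p"
  using picture by (auto simp: pictures_def)

lemma cell_in: "(i, j) \<in> grid \<Longrightarrow> (m (i, j), i mod 3, j mod 3) \<in> cells"
  using tiling by (auto simp: wang_tiling_def)

lemma state_in: "q \<in> grid \<Longrightarrow> state q \<in> nodes tile_graph"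
  using cell_in by (cases q) (auto simp: state.simps nodes_tile_graph)

lemma tile_of_state: "q \<in> grid \<Longrightarrow> tile_of (state q) = m q"
  using cell_in tile_of_code by (cases q) (auto simp: state.simps)

lemma lab_state: "q \<in> grid \<Longrightarrow> lab tile_graph (state q) = p $$ q"
  using tiling by (cases q) (auto simp: lab_tile_graph state_in tile_of_state wang_tiling_def)

lemma picture_entry: "q \<in> grid \<Longrightarrow> p $$ q \<in> \<Sigma>"
  using label_in[OF state_in[of q]] lab_tile_graph[OF state_in[of q]] lab_state[of q] by simp

text \<open>Positions at most one apart in each coordinate are told apart by residues, and so is the
  direction between them; distant cells may share a state. The colour conditions on edges come from
  the tiling.\<close>

lemma near_state:
  assumes "(i, j) \<in> grid" "(i', j') \<in> grid" "i \<le> Suc i'" "i' \<le> Suc i" "j \<le> Suc j'" "j' \<le> Suc j"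
  shows "state (i, j) = state (i', j') \<longleftrightarrow> i = i' \<and> j = j'"
    and "(state (i, j), state (i', j')) \<in> vert tile_graph \<longleftrightarrow> i' = Suc i \<and> j' = j"
    and "(state (i, j), state (i', j')) \<in> horiz tile_graph \<longleftrightarrow> i' = i \<and> j' = Suc j"
proof -
  have south: "south (m (i, j)) = north (m (i', j')) \<and> south (m (i, j)) \<in> Some ` colours W"
    if "i' = Suc i \<and> j' = j"
    using that assms(1,2) tiling unfolding wang_tiling_def by (metis Suc_eq_plus1 SigmaE2 lessThan_iff)
  have east: "east (m (i, j)) = west (m (i', j')) \<and> east (m (i, j)) \<in> Some ` colours W"
    if "i' = i \<and> j' = Suc j"
    using that assms(1,2) tiling unfolding wang_tiling_def by (metis Suc_eq_plus1 SigmaE2 lessThan_iff)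
  note c = cell_in[OF assms(1)] cell_in[OF assms(2)]
  have "state (i, j) = state (i', j') \<Longrightarrow> i = i' \<and> j = j'"
    using c near_mod_3(1)[OF assms(4,3)] near_mod_3(1)[OF assms(6,5)]
    by (auto simp: state.simps code_eq_iff)
  then show "state (i, j) = state (i', j') \<longleftrightarrow> i = i' \<and> j = j'" by blast
  show "(state (i, j), state (i', j')) \<in> vert tile_graph \<longleftrightarrow> i' = Suc i \<and> j' = j"
    unfolding state.simps vert_tile_graph_iff[OF c] near_mod_3[OF assms(3,4)] near_mod_3[OF assms(5,6)]
    using south by blast
  show "(state (i, j), state (i', j')) \<in> horiz tile_graph \<longleftrightarrow> i' = i \<and> j' = Suc j"
    unfolding state.simps horiz_tile_graph_iff[OF c] near_mod_3[OF assms(3,4)] near_mod_3[OF assms(5,6)]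
    using east by blast
qed

lemma block_subset: "(i, j) \<in> grid \<Longrightarrow> block i j \<subseteq> grid"
  by (auto simp: block_def)

lemma in_block: "(i, j) \<in> block i j"
  by (auto simp: block_def)

lemma block_near:
  assumes "(i, j) \<in> grid" "(a, b) \<in> block i j" "(a', b') \<in> block i j"
  shows "state (a, b) = state (a', b') \<longleftrightarrow> a = a' \<and> b = b'"
    and "(state (a, b), state (a', b')) \<in> vert tile_graph \<longleftrightarrow> a' = Suc a \<and> b' = b"
    and "(state (a, b), state (a', b')) \<in> horiz tile_graph \<longleftrightarrow> a' = a \<and> b' = Suc b"
proof -
  have "(a, b) \<in> grid" "(a', b') \<in> grid"
    using block_subset assms by blast+
  moreover have "a \<le> Suc a'" "a' \<le> Suc a" "b \<le> Suc b'" "b' \<le> Suc b"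
    using assms(2,3) by (auto simp: block_def)
  ultimately show "state (a, b) = state (a', b') \<longleftrightarrow> a = a' \<and> b = b'"
    and "(state (a, b), state (a', b')) \<in> vert tile_graph \<longleftrightarrow> a' = Suc a \<and> b' = b"
    and "(state (a, b), state (a', b')) \<in> horiz tile_graph \<longleftrightarrow> a' = a \<and> b' = Suc b"
    by (rule near_state)+
qed

lemma inj_on_block: "(i, j) \<in> grid \<Longrightarrow> inj_on state (block i j)"
  by (auto intro!: inj_onI simp: block_near(1))

text \<open>This rule fills cell \<open>(i, j)\<close>. The only created node is that of
  \<open>(i, j)\<close>, whose demanded neighbours lie in the block; the deactivated nodes are those
  with corner \<open>(i, j)\<close>, whose southern and eastern neighbours lie in the block
  too.\<close>

lemma block_rule:
  assumes ij: "(i, j) \<in> grid"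
  shows "(state ` block i j, state ` (block i j - {(i, j)}),
    state ` {q \<in> block i j. corner q \<noteq> (i, j)}) \<in> rules"
proof -
  let ?B = "block i j" and ?Q1 = "block i j - {(i, j)}"
    and ?Q2 = "{q \<in> block i j. corner q \<noteq> (i, j)}"
  \<comment> \<open>The root is \<open>(i - 1, j - 1)\<close>; dropping the bottom right cell
    removes no upper or left neighbour of another cell.\<close>
  have conn: "connected_graph (induced tile_graph (state ` T))" if "T = ?B \<or> T = ?Q1" for T
  proof (rule connected_graph_rooted)
    show "nodes (induced tile_graph (state ` T)) = state ` T"
      by (simp add: induced_def)
  next
    fix a b assume "(a, b) \<in> T"
    then show "i - 1 \<le> a \<and> j - 1 \<le> b" using that by (auto simp: block_def)
  next
    fix a b assume "(a, b) \<in> T" "i - 1 < a"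
    then show "(a - 1, b) \<in> T" using that by (auto simp: block_def)
  next
    fix a b assume "(a, b) \<in> T" "j - 1 < b"
    then show "(a, b - 1) \<in> T" using that by (auto simp: block_def)
  next
    fix a b assume ab: "(a, b) \<in> T" "(Suc a, b) \<in> T"
    then show "(state (a, b), state (Suc a, b)) \<in> vert (induced tile_graph (state ` T))"
      using block_near(2)[OF ij, of a b "Suc a" b] that by (auto simp: induced_def)
  next
    fix a b assume ab: "(a, b) \<in> T" "(a, Suc b) \<in> T"
    then show "(state (a, b), state (a, Suc b)) \<in> horiz (induced tile_graph (state ` T))"
      using block_near(3)[OF ij, of a b a "Suc b"] that by (auto simp: induced_def)
  qed
  have created: "(north (tile_of x) \<noteq> None \<longrightarrow> (\<exists>y\<in>state ` ?B. (y, x) \<in> vert tile_graph)) \<and>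
      (west (tile_of x) \<noteq> None \<longrightarrow> (\<exists>y\<in>state ` ?B. (y, x) \<in> horiz tile_graph))"
    if "x \<in> state ` ?B - state ` ?Q1" for x
  proof -
    have x: "x = state (i, j)" using that by blast
    have "(state (i - 1, j), x) \<in> vert tile_graph \<and> (i - 1, j) \<in> ?B"
      if "north (m (i, j)) \<noteq> None"
    proof -
      \<comment> \<open>The tiling leaves the northern edges of row 0 uncoloured.\<close>
      have "0 < i" using that tiling ij by (auto simp: wang_tiling_def intro: Suc_lessI gr0I)
      then show ?thesis
        unfolding x using block_near(2)[OF ij, of "i - 1" j i j] by (auto simp: block_def)
    qed
    moreover have "(state (i, j - 1), x) \<in> horiz tile_graph \<and> (i, j - 1) \<in> ?B"
      if "west (m (i, j)) \<noteq> None"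
    proof -
      have "0 < j" using that tiling ij by (auto simp: wang_tiling_def intro: Suc_lessI gr0I)
      then show ?thesis
        unfolding x using block_near(3)[OF ij, of i "j - 1" i j] by (auto simp: block_def)
    qed
    ultimately show ?thesis
      using tile_of_state[OF ij] unfolding x by auto
  qed
  have left: "(south (tile_of x) \<noteq> None \<longrightarrow> (\<exists>y\<in>state ` ?B. (x, y) \<in> vert tile_graph)) \<and>
      (east (tile_of x) \<noteq> None \<longrightarrow> (\<exists>y\<in>state ` ?B. (x, y) \<in> horiz tile_graph))"
    if outside: "x \<in> state ` ?B - state ` ?Q2" for x
  proof -
    obtain q where "x = state q" "q \<in> ?B" "corner q = (i, j)"
      using outside by blast
    then obtain a b where x: "x = state (a, b)" and ab: "(a, b) \<in> ?B" and c: "corner (a, b) = (i, j)"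
      by (cases q) blast
    have g: "(a, b) \<in> grid" using block_subset[OF ij] ab by blast
    have "(x, state (Suc a, b)) \<in> vert tile_graph \<and> (Suc a, b) \<in> ?B"
      if "south (m (a, b)) \<noteq> None"
    proof -
      have "a \<noteq> dim_row p - 1"
        using that tiling g unfolding wang_tiling_def by (metis SigmaE2 lessThan_iff)
      \<comment> \<open>Away from the last row \<open>corner\<close> is not clamped, so
        \<open>i = Suc a\<close>.\<close>
      then have "(Suc a, b) \<in> ?B"
        using c g ab by (auto simp: block_def)
      then show ?thesis
        unfolding x using block_near(2)[OF ij ab, of "Suc a" b] by auto
    qed
    moreover have "(x, state (a, Suc b)) \<in> horiz tile_graph \<and> (a, Suc b) \<in> ?B"
      if "east (m (a, b)) \<noteq> None"
    proof -
      have "b \<noteq> dim_col p - 1"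
        using that tiling g unfolding wang_tiling_def by (metis SigmaE2 lessThan_iff)
      then have "(a, Suc b) \<in> ?B"
        using c g ab by (auto simp: block_def)
      then show ?thesis
        unfolding x using block_near(3)[OF ij ab, of a "Suc b"] by auto
    qed
    ultimately show ?thesis
      using tile_of_state[OF g] unfolding x by auto
  qed
  have "state ` ?B \<subseteq> nodes tile_graph"
    using state_in block_subset[OF ij] by blast
  moreover have "state ` ?Q1 \<subseteq> state ` ?B" "state ` ?Q2 \<subseteq> state ` ?B"
    by blast+
  ultimately show ?thesis
    unfolding rules_def mem_Collect_eq prod.case
    using conn[of ?B] conn[of ?Q1] by (intro conjI ballI[OF created] ballI[OF left]; assumption?; simp)
qed

section \<open>Partially assembled pictures\<close>

lemma inj_place: "inj place"
  by (auto simp: place_def inj_on_def)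

lemma place_eq [simp]: "place q = place q' \<longleftrightarrow> q = q'"
  using inj_place by (simp add: inj_eq)

lemma position_place [simp]: "position (place q) = q"
  by (simp add: position_def inj_place)

lemma partial_simps:
  "nodes (partial S) = place ` S"
  "(place (i, j), place (i', j')) \<in> vert (partial S)
    \<longleftrightarrow> (i, j) \<in> S \<and> (i', j') \<in> S \<and> i' = Suc i \<and> j' = j"
  "(place (i, j), place (i', j')) \<in> horiz (partial S)
    \<longleftrightarrow> (i, j) \<in> S \<and> (i', j') \<in> S \<and> i' = i \<and> j' = Suc j"
  "q \<in> S \<Longrightarrow> lab (partial S) (place q) = p $$ q"
  by (auto simp: partial_def)

lemma pseudo_partial: "S \<subseteq> grid \<Longrightarrow> pseudo_picture_graph \<Sigma> (partial S)"
  using picture_entry finite_subset[of S grid]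
  by (auto simp: pseudo_picture_graph_def partial_def)

lemma grid_coords_partial: "grid_coords (partial grid) (dim_row p) (dim_col p) position"
  unfolding grid_coords_def
proof (intro conjI ballI)
  show "bij_betw position (nodes (partial grid)) grid"
    by (auto simp: partial_simps bij_betw_def inj_on_def image_image)
next
  fix x y assume "x \<in> nodes (partial grid)" "y \<in> nodes (partial grid)"
  then obtain i j i' j' where "x = place (i, j)" "y = place (i', j')" "(i, j) \<in> grid" "(i', j') \<in> grid"
    by (auto simp: partial_simps)
  then show "(x, y) \<in> vert (partial grid) \<longleftrightarrow> position y = (fst (position x) + 1, snd (position x))"
    and "(x, y) \<in> horiz (partial grid) \<longleftrightarrow> position y = (fst (position x), snd (position x) + 1)"
    by (auto simp: partial_simps)
qed

lemma picture_graph_partial: "picture_graph \<Sigma> (partial grid)"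
  using grid_coords_partial dims_pos pseudo_partial by (auto simp: picture_graph_def)

lemma represents_partial: "represents (partial grid) p"
proof -
  have "lab (partial grid) (inv_into (nodes (partial grid)) position q) = p $$ q" if "q \<in> grid" for q
  proof -
    have "inj_on position (nodes (partial grid))"
      using grid_coords_partial by (simp add: grid_coords_def bij_betw_def)
    then have "inv_into (nodes (partial grid)) position (position (place q)) = place q"
      using that by (intro inv_into_f_f) (simp_all add: partial_simps(1))
    then show ?thesis using that by (simp add: partial_simps)
  qed
  then have "p = mat (dim_row p) (dim_col p)
      (\<lambda>ij. lab (partial grid) (inv_into (nodes (partial grid)) position ij))"
    by (intro eq_matI) auto
  then show ?thesis
    unfolding represents_def using dims_pos grid_coords_partial by blast
qed

lemma connected_partial: "down_closed S \<Longrightarrow> connected_graph (partial S)"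
  by (rule connected_graph_rooted[where \<kappa> = place and T = S and r = 0 and c = 0])
    (auto simp: partial_simps elim: down_closedD)

text \<open>Every stage is cut out of the finished picture graph by its node set; down-closedness
  provides connectivity, with root \<open>(0, 0)\<close>.\<close>

lemma subgrid_partial:
  assumes "S \<subseteq> grid" "down_closed S"
  shows "subgrid \<Sigma> (partial S)"
proof -
  have "partial S = induced (partial grid) (place ` S)"
  proof -
    have "vert (partial S) = vert (partial grid) \<inter> place ` S \<times> place ` S"
      "horiz (partial S) = horiz (partial grid) \<inter> place ` S \<times> place ` S"
      using assms(1) by (auto simp: partial_def)
    moreover have "lab (partial S) = restrict (lab (partial grid)) (place ` S)"
      using assms(1) by (auto simp: partial_def fun_eq_iff restrict_def)
    ultimately show ?thesis
      by (simp add: induced_def partial_simps)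
  qed
  then show ?thesis
    using picture_graph_partial pseudo_partial[OF assms(1)] connected_partial[OF assms(2)] assms(1)
    unfolding subgrid_def partial_simps(1) by (metis image_mono partial_simps(1))
qed

lemma config_configuration:
  assumes "S \<subseteq> grid" "down_closed S"
  shows "is_configuration \<Sigma> automaton (config S)"
  using subgrid_partial[OF assms] assms(1) state_in lab_state
  by (auto simp: config_def partial_simps frontier_def)

section \<open>Filling one cell\<close>

text \<open>The first part ensures that filling \<open>(i, j)\<close> completes the neighbourhood of
  no cell outside the block, the second that no cell of the block was completed earlier.\<close>

lemma corner_block:
  assumes "(i, j) \<in> grid" "q \<in> grid"
  shows "corner q = (i, j) \<Longrightarrow> q \<in> block i j"
    and "q \<in> block i j \<Longrightarrow> corner q = (a, b) \<Longrightarrow> i \<le> a \<and> j \<le> b"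
  using assms by (cases q; auto simp: block_def min_def split: if_splits)+

text \<open>By down-closedness no cell below or to the right of \<open>(i, j)\<close> is in
  \<open>S\<close>, so a new edge joins \<open>(i, j)\<close> to its upper or left neighbour, inside
  the block. The other edges of the block are already present.\<close>

lemma partial_insert:
  assumes S: "down_closed S" "(i, j) \<notin> S" and BS: "block i j \<subseteq> insert (i, j) S"
  shows "vert (partial (insert (i, j) S)) = vert (partial S) \<union> vert (partial (block i j))"
    and "horiz (partial (insert (i, j) S)) = horiz (partial S) \<union> horiz (partial (block i j))"
proof -
  have "(a, b) \<in> S \<and> (Suc a, b) \<in> S \<or> (a, b) \<in> block i j \<and> (Suc a, b) \<in> block i j"
    if "(a, b) \<in> insert (i, j) S" "(Suc a, b) \<in> insert (i, j) S" for a b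
    using that down_closedD[OF S(1), of "Suc a" b a b] S(2) by (auto simp: block_def)
  then show "vert (partial (insert (i, j) S)) = vert (partial S) \<union> vert (partial (block i j))"
    using BS unfolding partial_def ppgraph.select_convs by blast
  have "(a, b) \<in> S \<and> (a, Suc b) \<in> S \<or> (a, b) \<in> block i j \<and> (a, Suc b) \<in> block i j"
    if "(a, b) \<in> insert (i, j) S" "(a, Suc b) \<in> insert (i, j) S" for a b
    using that down_closedD[OF S(1), of a "Suc b" a b] S(2) by (auto simp: block_def)
  then show "horiz (partial (insert (i, j) S)) = horiz (partial S) \<union> horiz (partial (block i j))"
    using BS unfolding partial_def ppgraph.select_convs by blast
qed

text \<open>The hyperedge of \<open>block_rule\<close> is glued with \<open>P\<close> the rest of
  the block and \<open>place (i, j)\<close> as the single fresh node. The hypothesis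
  \<open>below\<close> puts the rest of the block into \<open>S\<close> and keeps the enlarged set
  down-closed.\<close>

lemma config_step:
  assumes S: "S \<subseteq> grid" "down_closed S" "(0, 0) \<in> S" and ij: "(i, j) \<in> grid" "(i, j) \<notin> S"
    and below: "\<And>a b. a \<le> i \<Longrightarrow> b \<le> j \<Longrightarrow> (a, b) \<noteq> (i, j) \<Longrightarrow> (a, b) \<in> S"
  shows "sa_step \<Sigma> automaton (config S) (config (insert (i, j) S))"
proof -
  let ?X = "(i, j)" and ?B = "block i j"
  let ?S = "insert ?X S" and ?P = "place ` (?B - {?X})" and ?F = "{place ?X}"
  define g1 g2 where "g1 = restrict (state \<circ> position) (place ` S)"
    and "g2 = restrict (state \<circ> position) (place ` ?S)"
  have down: "down_closed ?S"
    unfolding down_closed_def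
    using below down_closedD[OF S(2)] by (metis insert_iff prod.inject)
  have BS: "?B - {?X} \<subseteq> S"
    using below unfolding block_def by (metis (no_types, lifting) DiffE SigmaE atLeastAtMost_iff singletonI subsetI)
  then have BS': "?B \<subseteq> ?S" by auto
  have PF: "?P \<union> ?F = place ` ?B" using in_block by blast
  have g1: "g1 (place q) = state q" if "q \<in> S" for q
    using that by (auto simp: g1_def)
  have g2: "g2 (place q) = state q" if "q \<in> ?S" for q
    using that by (auto simp: g2_def)
  have g2B: "g2 (place q) = state q" if "q \<in> ?B" for q
    using that BS' g2 by blast
  \<comment> \<open>The corner of a block cell lies weakly below and to the right of
    \<open>(i, j)\<close>, so \<open>S\<close> would contain \<open>(i, j)\<close> along with it.
    Hence all of \<open>P\<close> is active.\<close>
  have corner: "corner q \<notin> S" if "q \<in> ?B" for q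
  proof
    assume "corner q \<in> S"
    moreover obtain a b where "corner q = (a, b)" by fastforce
    ultimately show False
      using corner_block(2)[OF ij(1) _ that] block_subset[OF ij(1)] that down_closedD[OF S(2)] ij(2)
      by (metis subsetD)
  qed
  obtain e where e: "e \<in> hyperedges automaton" "ends automaton e = state ` ?B"
    "incoming automaton e = state ` (?B - {?X})"
    "outgoing automaton e = state ` {q \<in> ?B. corner q \<noteq> ?X}"
    using rule_hyperedge[OF block_rule[OF ij(1)]] by blast
  note inj = inj_on_block[OF ij(1)]
  \<comment> \<open>Between states of the block, edges of \<open>tile_graph\<close> are exactly grid
    adjacencies.\<close>
  have new:
    "{(x, y). x \<in> ?P \<union> ?F \<and> y \<in> ?P \<union> ?F \<and> (g2 x, g2 y) \<in> vert tile_graph} = vert (partial ?B)"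
    "{(x, y). x \<in> ?P \<union> ?F \<and> y \<in> ?P \<union> ?F \<and> (g2 x, g2 y) \<in> horiz tile_graph} = horiz (partial ?B)"
    unfolding PF using g2B block_near(2,3)[OF ij(1)] by (auto simp: partial_def)
  have iso: "graph_iso g1 (induced (partial S) ?P) (induced tile_graph (state ` (?B - {?X})))"
    unfolding graph_iso_def
  proof (intro conjI ballI)
    have "q = q'" if "q \<in> ?B - {?X}" "q' \<in> ?B - {?X}" "g1 (place q) = g1 (place q')" for q q'
    proof -
      have "q \<in> S" "q' \<in> S" using that BS by blast+
      then have "state q = state q'" using that(3) g1 by simp
      then show ?thesis using that inj_onD[OF inj] by blast
    qed
    then have "inj_on g1 ?P"
      by (auto intro!: inj_onI)
    moreover have "g1 ` ?P = state ` (?B - {?X})"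
      unfolding image_image using BS g1 by (intro image_cong) auto
    ultimately show "bij_betw g1 (nodes (induced (partial S) ?P))
        (nodes (induced tile_graph (state ` (?B - {?X}))))"
      by (simp add: bij_betw_def induced_def)
  next
    fix x y assume "x \<in> nodes (induced (partial S) ?P)" "y \<in> nodes (induced (partial S) ?P)"
    then obtain a b a' b' where xy: "x = place (a, b)" "y = place (a', b')"
      and ab: "(a, b) \<in> ?B - {?X}" "(a', b') \<in> ?B - {?X}"
      by (auto simp: induced_def)
    then have "(a, b) \<in> S" "(a', b') \<in> S" using BS by blast+
    then show "(x, y) \<in> vert (induced (partial S) ?P) \<longleftrightarrow>
        (g1 x, g1 y) \<in> vert (induced tile_graph (state ` (?B - {?X})))"
      and "(x, y) \<in> horiz (induced (partial S) ?P) \<longleftrightarrow>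
        (g1 x, g1 y) \<in> horiz (induced tile_graph (state ` (?B - {?X})))"
      using ab block_near(2,3)[OF ij(1), of a b a' b'] unfolding xy
      by (auto simp: induced_def partial_simps g1)
  next
    fix x assume "x \<in> nodes (induced (partial S) ?P)"
    then obtain q where x: "x = place q" and q: "q \<in> ?B - {?X}"
      by (auto simp: induced_def)
    then have "q \<in> S" using BS by blast
    then show "lab (induced tile_graph (state ` (?B - {?X}))) (g1 x) = lab (induced (partial S) ?P) x"
      using q S(1) lab_state[of q] unfolding x by (auto simp: induced_def partial_simps g1)
  qed
  \<comment> \<open>A transition needs a nonempty \<open>P\<close>. Even with truncated subtraction,
    \<open>(i - 1, j - 1)\<close> differs from \<open>(i, j)\<close> unless both coordinates are
    0.\<close>
  have "(i, j) \<noteq> (0, 0)" using S(3) ij(2) by metis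
  then have "(i - 1, j - 1) \<in> ?B - {?X}" by (auto simp: block_def)
  then have "?P \<noteq> {}" by blast
  \<comment> \<open>Inside the block no corner was filled before, so only the test against
    \<open>(i, j)\<close> remains; outside it nothing changes.\<close>
  have frontier: "frontier ?S = (frontier S - (?B - {?X})) \<union> {q \<in> ?B. corner q \<noteq> ?X}"
  proof -
    have "q \<in> frontier ?S \<longleftrightarrow> corner q \<noteq> ?X" if "q \<in> ?B" for q
      using that corner BS' unfolding frontier_def by blast
    moreover have "q \<in> frontier ?S \<longleftrightarrow> q \<in> frontier S" if "q \<notin> ?B" for q
    proof -
      have "q \<noteq> ?X" using that in_block by blast
      moreover have "corner q \<noteq> ?X" if "q \<in> S"
        using that corner_block(1)[OF ij(1)] S(1) \<open>q \<notin> ?B\<close> by blast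
      ultimately show ?thesis unfolding frontier_def by blast
    qed
    moreover have "?X \<notin> frontier S"
      using ij(2) unfolding frontier_def by blast
    ultimately show ?thesis by blast
  qed
  \<comment> \<open>Outgoing nodes are given as states; injectivity of \<open>state\<close> on the
    block turns membership back into a condition on cells.\<close>
  have out: "{x \<in> ?P \<union> ?F. g2 x \<in> state ` {q \<in> ?B. corner q \<noteq> ?X}} = place ` {q \<in> ?B. corner q \<noteq> ?X}"
  proof -
    have "g2 (place q) \<in> state ` {q \<in> ?B. corner q \<noteq> ?X} \<longleftrightarrow> corner q \<noteq> ?X" if "q \<in> ?B" for q
      unfolding g2B[OF that] using that inj_on_eq_iff[OF inj] by blast
    then show ?thesis unfolding PF by blast
  qed
  show ?thesis
    unfolding config_def g1_def[symmetric] g2_def[symmetric]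
  proof (rule sa_stepI[where e = e and P = ?P and F = ?F])
    show "is_configuration \<Sigma> automaton (partial S, place ` frontier S, g1)"
      using config_configuration[OF S(1,2)] by (simp only: config_def g1_def)
    show "is_configuration \<Sigma> automaton (partial ?S, place ` frontier ?S, g2)"
      using config_configuration[of ?S] S(1) ij(1) down unfolding config_def g2_def by blast
    show "e \<in> hyperedges automaton" by (rule e(1))
    show "?P \<subseteq> place ` frontier S"
      using BS corner by (auto simp: frontier_def)
    show "?F \<inter> nodes (partial S) = {}"
      using ij(2) by (auto simp: partial_simps)
    show "\<forall>x\<in>nodes (partial S). g2 x = g1 x"
      by (auto simp: partial_simps(1) g1 g2)
    show "nodes (partial ?S) = nodes (partial S) \<union> ?F"
      by (auto simp: partial_simps)
    show "\<forall>x\<in>nodes (partial ?S). lab (partial ?S) x = lab (underlying automaton) (g2 x)"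
      using lab_state S(1) ij(1) by (auto simp: partial_simps g2 subset_iff)
    show "?P \<noteq> {}" by fact
    show "graph_iso g1 (induced (partial S) ?P) (induced (edge_graph automaton e) (incoming automaton e))"
      using iso by (simp add: edge_graph_def e induced_induced image_mono)
    show "bij_betw g2 ?F (ends automaton e - incoming automaton e)"
    proof -
      have "?B - (?B - {?X}) = {?X}" using in_block by blast
      then have "state ` ?B - state ` (?B - {?X}) = {state ?X}"
        using inj_on_image_set_diff[OF inj, of ?B "?B - {?X}"] by (metis Diff_subset image_empty image_insert)
      then show ?thesis using g2B[OF in_block] by (simp add: bij_betw_def e)
    qed
    show "vert (partial ?S) = vert (partial S) \<union> {(x, y). x \<in> ?P \<union> ?F \<and> y \<in> ?P \<union> ?F \<and>
        (g2 x, g2 y) \<in> vert (underlying automaton)}"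
      unfolding automaton_simps(1) new by (rule partial_insert(1)[OF S(2) ij(2) BS'])
    show "horiz (partial ?S) = horiz (partial S) \<union> {(x, y). x \<in> ?P \<union> ?F \<and> y \<in> ?P \<union> ?F \<and>
        (g2 x, g2 y) \<in> horiz (underlying automaton)}"
      unfolding automaton_simps(1) new by (rule partial_insert(2)[OF S(2) ij(2) BS'])
    show "place ` frontier ?S = place ` frontier S - ?P \<union> {x \<in> ?P \<union> ?F. g2 x \<in> outgoing automaton e}"
    proof -
      have "place ` (frontier S - (?B - {?X})) = place ` frontier S - ?P"
        by (rule image_set_diff[OF inj_place])
      then show ?thesis unfolding e(4) out frontier image_Un by blast
    qed
  qed
qed

section \<open>The complete assembly\<close>

text \<open>Clamping keeps every corner inside the grid.\<close>

lemma frontier_grid: "frontier grid = {}"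
  using dims_pos by (auto simp: frontier_def)

lemma config_reaches_grid:
  assumes "S \<subseteq> grid" "down_closed S" "(0, 0) \<in> S"
  shows "(sa_step \<Sigma> automaton)\<^sup>*\<^sup>* (config S) (config grid)"
  using assms
proof (induction "card (grid - S)" arbitrary: S rule: less_induct)
  case less
  show ?case
  proof (cases "S = grid")
    case False
    \<comment> \<open>A missing cell of least coordinate sum: every other cell weakly above and to
      the left has a smaller sum and is therefore already filled.\<close>
    obtain i j where ij: "(i, j) \<in> grid - S"
      and min: "\<And>q. q \<in> grid - S \<Longrightarrow> i + j \<le> fst q + snd q"
    proof -
      have ex: "\<exists>q. q \<in> grid - S" using False less.prems by blast
      obtain q where "q \<in> grid - S" "\<And>q'. q' \<in> grid - S \<Longrightarrow> fst q + snd q \<le> fst q' + snd q'"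
        using ex_has_least_nat[of "\<lambda>q. q \<in> grid - S" _ "\<lambda>q. fst q + snd q"] ex by blast
      then show thesis using that by (cases q) auto
    qed
    have below: "(a, b) \<in> S" if "a \<le> i" "b \<le> j" "(a, b) \<noteq> (i, j)" for a b
      using min[of "(a, b)"] ij that by force
    let ?S = "insert (i, j) S"
    have "sa_step \<Sigma> automaton (config S) (config ?S)"
      using config_step[OF less.prems] ij below by blast
    moreover have "down_closed ?S"
      unfolding down_closed_def
      using below down_closedD[OF less.prems(2)] by (metis insert_iff prod.inject)
    moreover have "card (grid - ?S) < card (grid - S)"
      using ij by (intro psubset_card_mono) auto
    ultimately show ?thesis
      using less.hyps[of ?S] ij less.prems(1) by (meson DiffD1 converse_rtranclp_into_rtranclp insertI2 insert_subset less.prems(3))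
  qed simp
qed

text \<open>At \<open>(0, 0)\<close> the block is a single cell, so \<open>block_rule\<close> yields
  a hyperedge without incoming nodes.\<close>

lemma initial_config:
  obtains e where "e \<in> initials automaton" "initial_configuration automaton e = config {(0, 0)}"
proof -
  have o: "(0, 0) \<in> grid" using dims_pos by simp
  have B: "block 0 0 = {(0, 0)}" by (auto simp: block_def)
  obtain e where e: "e \<in> hyperedges automaton" "ends automaton e = state ` block 0 0"
    "incoming automaton e = state ` (block 0 0 - {(0, 0)})"
    "outgoing automaton e = state ` {q \<in> block 0 0. corner q \<noteq> (0, 0)}"
    using rule_hyperedge[OF block_rule[OF o]] by blast
  have pl: "place (0, 0) = state (0, 0)"
    by (simp add: place_def prod_encode_def)
  have inv: "position (state (0, 0)) = (0, 0)"
    using position_place[of "(0, 0)"] unfolding pl .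
  \<comment> \<open>The one-cell picture has no edges, so the induced graph must not contain a
    loop.\<close>
  have "(state (0, 0), state (0, 0)) \<notin> vert tile_graph \<union> horiz tile_graph"
    using near_state(2,3)[OF o o] by simp
  then have "edge_graph automaton e = partial {(0, 0)}"
    using lab_state[OF o]
    by (auto simp: edge_graph_def e(2) B induced_def partial_def pl inv restrict_def fun_eq_iff)
  moreover have "outgoing automaton e = place ` frontier {(0, 0)}"
    by (auto simp: e(4) B frontier_def pl)
  moreover have "restrict id (ends automaton e) = restrict (state \<circ> position) (place ` {(0, 0)})"
    by (auto simp: e(2) B pl inv restrict_def fun_eq_iff)
  ultimately have "initial_configuration automaton e = config {(0, 0)}"
    by (simp only: initial_configuration_def config_def)
  moreover have "e \<in> initials automaton"
    using e(1,3) B by (simp add: initials_iff)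
  ultimately show thesis using that by blast
qed

lemma accepted: "p \<in> picture_language (graph_language \<Sigma> automaton)"
proof -
  obtain e where e: "e \<in> initials automaton" "initial_configuration automaton e = config {(0, 0)}"
    by (rule initial_config)
  have "(sa_step \<Sigma> automaton)\<^sup>*\<^sup>* (config {(0, 0)}) (config grid)"
    using dims_pos by (intro config_reaches_grid) (auto simp: down_closed_def)
  then have "(sa_step \<Sigma> automaton)\<^sup>*\<^sup>* (initial_configuration automaton e)
      (partial grid, {}, restrict (state \<circ> position) (place ` grid))"
    unfolding e(2) config_def[of grid] frontier_grid by simp
  then show ?thesis
    unfolding picture_language_def graph_language_def
    using e(1) picture_graph_partial represents_partial by blast
qed

end

theorem theorem1:
  fixes \<Sigma> :: "'a set" and L :: "'a mat set"
  assumes "finite \<Sigma>" and "recognizable \<Sigma> L"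
  shows "\<exists>A :: (nat, nat, 'a) sa_automaton.
           sa_hypergraph_automaton \<Sigma> A \<and> picture_language (graph_language \<Sigma> A) = L"
proof -
  obtain W :: "('a, nat) wang_tiles" where W: "wang_tile_system \<Sigma> W" and L: "L = wang_language \<Sigma> W"
    using assms(2) by (auto simp: recognizable_def)
  have "finite (tiles W \<times> {..<3::nat} \<times> {..<3::nat})"
    using W by (simp add: wang_tile_system_def)
  then obtain \<nu> :: "('a, nat) wang_tile \<times> nat \<times> nat \<Rightarrow> nat"
    where "inj_on \<nu> (tiles W \<times> {..<3} \<times> {..<3})"
    using finite_imp_inj_to_nat_seg by blast
  then interpret coded_tiles \<Sigma> W \<nu>
    using W by unfold_locales
  \<comment> \<open>The automaton depends only on \<open>W\<close> and the code, so interpreting the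
    locale separately for each \<open>p\<close> always speaks of the same automaton.\<close>
  have "p \<in> picture_language (graph_language \<Sigma> automaton)" if p: "p \<in> wang_language \<Sigma> W" for p
  proof -
    obtain m where "p \<in> pictures \<Sigma>" "wang_tiling W p m"
      using p by (auto simp: wang_language_def)
    then interpret tiled_picture \<Sigma> W \<nu> p m
      by unfold_locales
    show ?thesis by (rule accepted)
  qed
  then show ?thesis
    using sa_automaton accepted_subset L by blast
qed

end
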